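(* Let $n\in\mathbb{N}$, $s\in\mathbb{C}\setminus\{-1,-2,-3,\dots\}$ and $x\in\mathbb{C}$. Then \begin{align*} &\sum_{k=0}^{n}\binom{s+n}{k}\Big\{(\psi(s+n+1)-\psi(s+n-k+1))^2+\psi'(s+n+1)-\psi'(s+n-k+1)\Big\}x^k\\ &=(1+x)^n\sum_{k=0}^{n-1}\frac{1}{k+1}\binom{s+k}{k}\Big\{2(\psi(s+k+1)-\psi(s+1))\\ &\qquad+s\Big[(\psi(s+k+1)-\psi(s+1))^2+\psi'(s+k+1)-\psi'(s+1)\Big]\Big\}\left(\frac{x}{x+1}\right)^{k+1}. \end{align*}
   Context: $\psi=\Gamma'/\Gamma$ is the digamma function and $\psi'$ its derivative (trigamma function). For $z\in\mathbb{C}$ and $k\in\mathbb{N}_0$, $\binom{z}{k}=\frac{z(z-1)\cdots(z-k+1)}{k!}$. For $0\le k\le n-1$ the product $(1+x)^n\left(\frac{x}{x+1}\right)^{k+1}$ is understood as the polynomial $x^{k+1}(1+x)^{n-k-1}$, so the identity is meaningful for all $x\in\mathbb{C}$, including $x=-1$. *)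

theory Defs
  imports "HOL-Analysis.Analysis"
begin

text \<open>
  The library constant \<^term>\<open>Digamma\<close> is introduced through a limit; the following fact
  confirms that it is the logarithmic derivative of \<^term>\<open>Gamma\<close>.
\<close>

lemma Digamma_eq_deriv_Gamma_div_Gamma:
  fixes z :: complex
  assumes "z \<notin> \<int>\<^sub>\<le>\<^sub>0"
  shows "Digamma z = deriv Gamma z / Gamma z"
proof -
  have "(Gamma has_field_derivative (Gamma z * Digamma z)) (at z)"
    using assms by (rule has_field_derivative_Gamma)
  then have "deriv Gamma z = Gamma z * Digamma z"
    by (rule DERIV_imp_deriv)
  with assms show ?thesis
    by (simp add: Gamma_eq_zero_iff)
qed

end

theory Submission
  imports Defs
begin

text \<open>
  The identity is the second derivative with respect to \<open>s\<close> of
  \<open>(\<Sum>k\<le>n. (s + n gchoose k) * x ^ k) = (1 + x) ^ n +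
    (\<Sum>k<n. s / (k + 1) * (s + k gchoose k) * x ^ (k + 1) * (1 + x) ^ (n - k - 1))\<close>:
  differentiating a binomial coefficient in its upper argument produces differences of
  digamma values.
\<close>

lemma gbinomial_Suc_absorb:
  fixes z :: "'a :: field_char_0"
  shows "z gchoose Suc k = (z gchoose k) * (z - of_nat k) / of_nat (Suc k)"
  by (simp add: gbinomial_prod_rev field_simps)

text \<open>Taking the second variable as 1 in \<open>gbinomial_partial_sum_poly_xpos\<close>
  re-expands the sum in powers of \<open>1 + x\<close>. The term \<open>k = 0\<close> gives
  \<open>(1 + x) ^ n\<close>; in the others, absorption of the lower index \<open>Suc k\<close> at
  \<open>s + of_nat k\<close> pulls out the factor \<open>s\<close>.\<close>

lemma gbinomial_partial_sum_expansion:
  fixes s x :: "'a :: field_char_0"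
  shows "(\<Sum>k\<le>n. ((s + of_nat n) gchoose k) * x ^ k) =
    (1 + x) ^ n + (\<Sum>k<n. 1 / (of_nat k + 1) * (s * ((s + of_nat k) gchoose k)) *
      (x ^ (k + 1) * (1 + x) ^ (n - k - 1)))"
proof -
  have "(\<Sum>k\<le>n. ((s + of_nat n) gchoose k) * x ^ k) =
      (\<Sum>k\<le>n. (of_nat k + s - 1 gchoose k) * x ^ k * (1 + x) ^ (n - k))"
    using gbinomial_partial_sum_poly_xpos[of n s x 1] by (simp add: add_ac)
  also have "\<dots> = (1 + x) ^ n +
      (\<Sum>k<n. (s + of_nat k gchoose Suc k) * x ^ Suc k * (1 + x) ^ (n - Suc k))"
    by (subst sum.atMost_shift) (simp add: add_ac)
  also have "(\<Sum>k<n. (s + of_nat k gchoose Suc k) * x ^ Suc k * (1 + x) ^ (n - Suc k)) =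
      (\<Sum>k<n. 1 / (of_nat k + 1) * (s * ((s + of_nat k) gchoose k)) *
        (x ^ (k + 1) * (1 + x) ^ (n - k - 1)))"
    by (simp add: gbinomial_Suc_absorb ac_simps)
  finally show ?thesis .
qed

lemma plus_of_nat_notin_nonpos_Ints:
  fixes z :: "'a :: ring_char_0"
  assumes "z \<notin> \<int>\<^sub>\<le>\<^sub>0"
  shows "z + of_nat m \<notin> \<int>\<^sub>\<le>\<^sub>0"
  using nonpos_Ints_diff_Nats[of "z + of_nat m" "of_nat m"] assms by auto

text \<open>Each step of the induction on \<open>k\<close> multiplies by a multiple of
  \<open>z - of_nat k\<close>, which adds \<open>1 / (z - of_nat k)\<close> to the logarithmic
  derivative. This is the increment of \<open>Digamma\<close> from \<open>z - of_nat k\<close> to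
  \<open>z - of_nat k + 1\<close>, so the differences telescope.\<close>

lemma has_field_derivative_gbinomial:
  fixes z :: complex
  assumes "z - of_nat k + 1 \<notin> \<int>\<^sub>\<le>\<^sub>0"
  shows "((\<lambda>z. z gchoose k) has_field_derivative
           (z gchoose k) * (Digamma (z + 1) - Digamma (z - of_nat k + 1))) (at z)"
  using assms
proof (induction k)
  case 0
  show ?case by simp
next
  case (Suc k)
  have *: "z - of_nat k \<notin> \<int>\<^sub>\<le>\<^sub>0"
    using Suc.prems by simp
  then have nz: "z - of_nat k \<noteq> 0"
    by auto
  have k_nz: "1 + complex_of_nat k \<noteq> 0"
    by (metis of_nat_Suc of_nat_neq_0)
  have IH: "((\<lambda>z. z gchoose k) has_field_derivative
      (z gchoose k) * (Digamma (z + 1) - Digamma (z - of_nat k + 1))) (at z)"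
    using plus_of_nat_notin_nonpos_Ints[OF *, of 1] by (intro Suc.IH) simp
  have "((\<lambda>w. (w gchoose k) * (w - of_nat k) / of_nat (Suc k)) has_field_derivative
      ((z gchoose k) * (Digamma (z + 1) - Digamma (z - of_nat k + 1)) * (z - of_nat k) +
        (z gchoose k)) / of_nat (Suc k)) (at z)"
    by (auto simp: k_nz intro!: derivative_eq_intros IH)
  also have "((z gchoose k) * (Digamma (z + 1) - Digamma (z - of_nat k + 1)) * (z - of_nat k) +
        (z gchoose k)) / of_nat (Suc k) =
      (z gchoose Suc k) * (Digamma (z + 1) - Digamma (z - of_nat (Suc k) + 1))"
    using nz k_nz
    by (simp add: gbinomial_Suc_absorb Digamma_plus1 divide_simps) (simp add: algebra_simps)
  finally show ?case
    by (simp only: gbinomial_Suc_absorb)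
qed

lemma has_field_derivative_Digamma:
  fixes z :: complex
  assumes "z \<notin> \<int>\<^sub>\<le>\<^sub>0"
  shows "(Digamma has_field_derivative deriv Digamma z) (at z)"
  using has_field_derivative_Polygamma[OF assms, of 0] DERIV_imp_deriv by fastforce

text \<open>The square comes from the product rule: differentiating the binomial coefficient
  reproduces it with a second copy of the digamma difference.\<close>

lemma has_field_derivative_gbinomial2:
  fixes z :: complex
  assumes "z - of_nat k + 1 \<notin> \<int>\<^sub>\<le>\<^sub>0"
  shows "((\<lambda>z. (z gchoose k) * (Digamma (z + 1) - Digamma (z - of_nat k + 1)))
    has_field_derivative (z gchoose k) * ((Digamma (z + 1) - Digamma (z - of_nat k + 1))\<^sup>2 +
      deriv Digamma (z + 1) - deriv Digamma (z - of_nat k + 1))) (at z)"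
proof -
  have "z + 1 \<notin> \<int>\<^sub>\<le>\<^sub>0"
    using plus_of_nat_notin_nonpos_Ints[OF assms, of k] by (simp add: algebra_simps)
  note D = DERIV_chain2[OF has_field_derivative_Digamma]
  show ?thesis
    by (rule derivative_eq_intros D has_field_derivative_gbinomial refl assms \<open>z + 1 \<notin> \<int>\<^sub>\<le>\<^sub>0\<close>)+
      (simp add: power2_eq_square algebra_simps)
qed

text \<open>Uniqueness of derivatives is applied twice. The first time it must give
  \<open>f' = g'\<close> on all of the open set, since agreement at \<open>z\<close> alone could not
  be differentiated again.\<close>

lemma second_derivatives_eq:
  assumes "open S" "z \<in> S" "\<And>w. w \<in> S \<Longrightarrow> f w = g w"
    and "\<And>w. w \<in> S \<Longrightarrow> (f has_field_derivative f' w) (at w)"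
    and "\<And>w. w \<in> S \<Longrightarrow> (g has_field_derivative g' w) (at w)"
    and f'': "(f' has_field_derivative f'') (at z)"
    and g'': "(g' has_field_derivative g'') (at z)"
  shows "f'' = g''"
proof -
  have "f' w = g' w" if "w \<in> S" for w
    using has_field_derivative_transform_within_open[of f "f' w" w S g] assms that DERIV_unique
    by metis
  then show ?thesis
    using has_field_derivative_transform_within_open[OF f'' assms(1,2), of g'] g'' DERIV_unique
    by metis
qed

theorem theorem2p4:
  fixes n :: nat and s x :: complex
  assumes "n \<ge> 1"
    and "\<And>m::nat. m \<ge> 1 \<Longrightarrow> s \<noteq> - of_nat m"
  shows "(\<Sum>k=0..n. ((s + of_nat n) gchoose k) *
            ((Digamma (s + of_nat n + 1) - Digamma (s + of_nat n - of_nat k + 1))^2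
             + deriv Digamma (s + of_nat n + 1) - deriv Digamma (s + of_nat n - of_nat k + 1))
            * x ^ k)
       = (\<Sum>k=0..n-1. 1 / (of_nat k + 1) * ((s + of_nat k) gchoose k) *
            (2 * (Digamma (s + of_nat k + 1) - Digamma (s + 1))
             + s * ((Digamma (s + of_nat k + 1) - Digamma (s + 1))^2
                    + deriv Digamma (s + of_nat k + 1) - deriv Digamma (s + 1)))
            * (x ^ (k + 1) * (1 + x) ^ (n - k - 1)))"
proof -
  \<comment> \<open>The plane without -1, -2, ...: the parameters allowed for \<open>s\<close>, and
    an open set because the non-positive integers are closed.\<close>
  define S :: "complex set" where "S = {w. w + 1 \<notin> \<int>\<^sub>\<le>\<^sub>0}"
  have "S = (\<lambda>w. w + 1) -` (- \<int>\<^sub>\<le>\<^sub>0)"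
    by (auto simp: S_def)
  then have "open S"
    by (simp add: open_vimage open_Compl closed_nonpos_Ints continuous_intros)
  have "s \<in> S"
    unfolding S_def
  proof (clarify elim!: nonpos_Ints_cases')
    fix m :: nat
    assume "s + 1 = - of_nat m"
    then have "s = - of_nat (Suc m)"
      by (simp add: algebra_simps eq_neg_iff_add_eq_0)
    with assms(2)[of "Suc m"] show False
      by simp
  qed
  \<comment> \<open>As functions of \<open>w\<close>, \<open>B j k\<close> has first derivative
    \<open>B j k w * H j k w\<close> and second derivative \<open>B j k w * H' j k w\<close>. The
    left side of the identity uses \<open>j = n\<close>, the right side
    \<open>j = k\<close>.\<close>
  define B where "B j k w = ((w + of_nat j) gchoose k)" for j k and w :: complex
  define H where "H j k w = Digamma (w + of_nat j + 1) - Digamma (w + of_nat j - of_nat k + 1)"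
    for j k and w :: complex
  define H' where "H' j k w = (H j k w)\<^sup>2 +
      deriv Digamma (w + of_nat j + 1) - deriv Digamma (w + of_nat j - of_nat k + 1)"
    for j k and w :: complex
  define c where "c k = x ^ (k + 1) * (1 + x) ^ (n - k - 1)" for k
  \<comment> \<open>For \<open>k \<le> j\<close> the argument is \<open>w + 1\<close> moved right by
    the natural number \<open>j - k\<close>, so it cannot reach a pole.\<close>
  have shift: "w + of_nat j - of_nat k + 1 \<notin> \<int>\<^sub>\<le>\<^sub>0" if "w \<in> S" "k \<le> j" for w j k
    using plus_of_nat_notin_nonpos_Ints[of "w + 1" "j - k"] that
    by (simp add: S_def of_nat_diff algebra_simps)
  have B1: "(B j k has_field_derivative B j k w * H j k w) (at w)" if "w \<in> S" "k \<le> j" for w j k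
    using has_field_derivative_gbinomial[OF shift[OF that]]
    by (subst (asm) DERIV_shift) (simp add: B_def[abs_def] H_def)
  have B2: "((\<lambda>w. B j k w * H j k w) has_field_derivative B j k w * H' j k w) (at w)"
    if "w \<in> S" "k \<le> j" for w j k
    using has_field_derivative_gbinomial2[OF shift[OF that]]
    by (subst (asm) DERIV_shift) (simp add: B_def[abs_def] H_def[abs_def] H'_def)
  have "(\<Sum>k\<le>n. B n k s * H' n k s * x ^ k) =
      (\<Sum>k<n. 1 / (of_nat k + 1) * (2 * (B k k s * H k k s) + s * (B k k s * H' k k s)) * c k)"
  proof (rule second_derivatives_eq[OF \<open>open S\<close> \<open>s \<in> S\<close>])
    fix w assume "w \<in> S"
    show "(\<Sum>k\<le>n. B n k w * x ^ k) =
        (1 + x) ^ n + (\<Sum>k<n. 1 / (of_nat k + 1) * (w * B k k w) * c k)"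
      unfolding B_def c_def by (rule gbinomial_partial_sum_expansion)
    show "((\<lambda>w. \<Sum>k\<le>n. B n k w * x ^ k) has_field_derivative
        (\<Sum>k\<le>n. B n k w * H n k w * x ^ k)) (at w)"
      by (intro DERIV_sum DERIV_cmult_right B1 \<open>w \<in> S\<close>) simp
    \<comment> \<open>The summand \<open>(1 + x) ^ n\<close> is constant in \<open>w\<close> and
      drops out here.\<close>
    show "((\<lambda>w. (1 + x) ^ n + (\<Sum>k<n. 1 / (of_nat k + 1) * (w * B k k w) * c k))
        has_field_derivative
        (\<Sum>k<n. 1 / (of_nat k + 1) * (B k k w + w * (B k k w * H k k w)) * c k)) (at w)"
      by (rule derivative_eq_intros B1 \<open>w \<in> S\<close> order_refl refl)+ (simp add: algebra_simps)
  next
    show "((\<lambda>w. \<Sum>k\<le>n. B n k w * H n k w * x ^ k) has_field_derivative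
        (\<Sum>k\<le>n. B n k s * H' n k s * x ^ k)) (at s)"
      by (intro DERIV_sum DERIV_cmult_right B2 \<open>s \<in> S\<close>) simp
    \<comment> \<open>Differentiating \<open>w * B k k w\<close> twice gives twice the first
      derivative of \<open>B k k\<close> plus \<open>w\<close> times the second; this is the source
      of the 2 and of the factor \<open>s\<close>.\<close>
    show "((\<lambda>w. \<Sum>k<n. 1 / (of_nat k + 1) * (B k k w + w * (B k k w * H k k w)) * c k)
        has_field_derivative
        (\<Sum>k<n. 1 / (of_nat k + 1) * (2 * (B k k s * H k k s) + s * (B k k s * H' k k s)) * c k))
        (at s)"
      by (rule derivative_eq_intros B1 B2 \<open>s \<in> S\<close> order_refl refl)+ (simp add: algebra_simps)
  qed
  \<comment> \<open>Here \<open>n \<ge> 1\<close> matters: with truncated subtraction,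
    \<open>{0..n-1}\<close> would be \<open>{0}\<close> rather than empty for
    \<open>n = 0\<close>.\<close>
  moreover have "{0..n} = {..n}" "{0..n-1} = {..<n}"
    using assms(1) by auto
  ultimately show ?thesis
    by (simp add: B_def H_def H'_def c_def algebra_simps)
qed

end
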